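(* Let $a,b,c$ be nonnegative real numbers with $a+b+c=1$, and let $f(a,b,c)$ be the optimal bounding constant on $\mathbb{L}_3^+$ of the bounded ratio $a\,\alpha^{23|1}+b\,\alpha^{13|2}+c\,\alpha^{12|3}$, i.e. the infimum of all $C>0$ such that \[ \Bigl(\tfrac{p_{23}p_{11}}{p_{12}p_{13}}\Bigr)^{a}\Bigl(\tfrac{p_{13}p_{22}}{p_{12}p_{23}}\Bigr)^{b}\Bigl(\tfrac{p_{12}p_{33}}{p_{13}p_{23}}\Bigr)^{c}\le C \quad\text{for all }(p_{ij})\in\mathbb{L}_3^+. \] Then: (1) If $a^2+b^2+c^2-2ab-2ac-2bc\le 0$, then $f(a,b,c)=1$. (2) If $a^2+b^2+c^2-2ab-2ac-2bc\ge 0$, $a\ge b$ and $a\ge c$, then \[ f(a,b,c)=2\cdot a^a\cdot b^b\cdot c^c\cdot(2a-1)^{2a-1}\cdot(1-2b)^{2b-1}\cdot(1-2c)^{2c-1}. \]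
   Context: A Lorentzian matrix is a real symmetric matrix with nonnegative entries having at most one positive eigenvalue; $\mathbb{L}_3^+$ is the set of $3\times 3$ Lorentzian matrices with all entries positive. The triangular ratios are $\alpha^{ij|k}=\mathbf{e}_{ij}+\mathbf{e}_{kk}-\mathbf{e}_{ik}-\mathbf{e}_{jk}$ (with $\mathbf{e}_{ji}=\mathbf{e}_{ij}$), corresponding to the monomials displayed in the claim. Powers $0^0$ are interpreted as $1$. *)

theory Defs
  imports
    "Jordan_Normal_Form.Char_Poly"
    "HOL-Library.Extended_Real"
begin

text \<open>Eigenvalues are counted with algebraic multiplicity, as roots of the
  characteristic polynomial.\<close>

definition Lorentzian_mat :: "nat \<Rightarrow> real mat \<Rightarrow> bool" where
  "Lorentzian_mat n P \<longleftrightarrow>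
     P \<in> carrier_mat n n \<and> transpose_mat P = P \<and>
     (\<forall>i<n. \<forall>j<n. 0 \<le> P $$ (i, j)) \<and>
     size {# x \<in># proots (char_poly P). 0 < x #} \<le> 1"

definition Lorentzian_pos :: "nat \<Rightarrow> real mat set" where
  "Lorentzian_pos n =
     {P. Lorentzian_mat n P \<and> (\<forall>i<n. \<forall>j<n. 0 < P $$ (i, j))}"

text \<open>The Laurent monomial with exponent vector
  \<open>\<alpha>\<^sup>i\<^sup>j\<^sup>|\<^sup>k = e\<^sub>i\<^sub>j + e\<^sub>k\<^sub>k - e\<^sub>i\<^sub>k - e\<^sub>j\<^sub>k\<close>.
  Matrices are indexed from 0, so the indices 1, 2, 3 become 0, 1, 2.\<close>

definition triangular_ratio :: "nat \<Rightarrow> nat \<Rightarrow> nat \<Rightarrow> real mat \<Rightarrow> real" where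
  "triangular_ratio i j k P =
     (P $$ (i, j) * P $$ (k, k)) / (P $$ (i, k) * P $$ (j, k))"

text \<open>The ratios are positive on \<^term>\<open>Lorentzian_pos 3\<close>, so the library's
  \<^term>\<open>0 powr 0 = (0::real)\<close> plays no role here.  The infimum is taken in the
  extended reals: an unbounded ratio has optimal constant \<^term>\<open>\<infinity>::ereal\<close>.\<close>

definition optimal_bound :: "real \<Rightarrow> real \<Rightarrow> real \<Rightarrow> ereal" where
  "optimal_bound a b c =
     Inf (ereal ` {C. 0 < C \<and> (\<forall>P \<in> Lorentzian_pos 3.
       triangular_ratio 1 2 0 P powr a *
       triangular_ratio 0 2 1 P powr b *
       triangular_ratio 0 1 2 P powr c \<le> C)})"

text \<open>Real power with the convention \<open>0\<^sup>0 = 1\<close>.\<close>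

definition rpow :: "real \<Rightarrow> real \<Rightarrow> real" where
  "rpow x y = (if x = 0 \<and> y = 0 then 1 else x powr y)"

end

theory Submission
  imports Defs
begin

text \<open>
  The three triangular ratios \<open>x, y, z\<close> are coordinates on the matrices modulo diagonal scaling:
  \<open>P\<close> may be taken with off-diagonal entries \<open>1\<close> and diagonal \<open>x, y, z\<close>, and it is Lorentzian iff
  its \<open>2\<times>2\<close> principal minors are nonpositive and \<open>x + y + z \<le> 2 + x y z\<close>.
  At most one ratio exceeds \<open>1\<close>; say \<open>y, z < 1\<close>. With \<open>y = (r - 1)/(r + 1)\<close> and
  \<open>z = (s - 1)/(s + 1)\<close> the determinant condition becomes \<open>x \<le> 1 + 2/(r + s)\<close>.
  In the variables \<open>1/r\<close>, \<open>1/s\<close> the logarithm of the monomial is concave, so it is bounded by its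
  tangent at any critical point; the inequality needed is
  \<open>(p + q)\<^sup>2/(r + s) \<le> p\<^sup>2/r + q\<^sup>2/s\<close>. The weights with critical point \<open>(p, q)\<close> are proportional to
  \<open>(p + q)(p + q + 2), p\<^sup>2 - 1, q\<^sup>2 - 1\<close>, and these are exactly the ones of positive
  discriminant whose first entry is the largest.
  If the discriminant is nonpositive, the critical point has moved to infinity and the tangent
  there gives the bound \<open>1\<close>.
\<close>

section \<open>Weighted logarithms on the normalised region\<close>

definition region :: "real \<Rightarrow> real \<Rightarrow> real \<Rightarrow> bool" where
  "region x y z \<longleftrightarrow> 0 < x \<and> 0 < y \<and> 0 < z \<and> x * y \<le> 1 \<and> x * z \<le> 1 \<and> y * z \<le> 1 \<and>
     x + y + z \<le> 2 + x * y * z"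

text \<open>At \<open>p = 1\<close>, the critical point of a vanishing weight, \<open>log_ratio 1 = ln 0 = 0\<close> is a junk value
  that only occurs multiplied by \<open>0\<close>.\<close>
definition log_ratio :: "real \<Rightarrow> real" where
  "log_ratio r = ln ((r - 1) / (r + 1))"

section \<open>Tangent inequalities in the coordinates r and s\<close>

text \<open>\<open>log_ratio r\<close> is concave in \<open>1/r\<close>; this is its tangent at
  \<open>1/p\<close>, multiplied by \<open>p^2 - 1\<close> so that it remains meaningful at
  \<open>p = 1\<close>.\<close>

lemma log_ratio_tangent:
  assumes "1 \<le> p" "1 < r"
  shows "(p\<^sup>2 - 1) * (log_ratio r - log_ratio p) \<le> 2 * p - 2 * p\<^sup>2 / r"
proof (cases "p = 1")
  case True
  then show ?thesis using assms by (simp add: field_simps)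
next
  case False
  then have p: "1 < p" using assms by simp
  define f where "f = (\<lambda>t::real. (p\<^sup>2 - 1) * (ln (t - 1) - ln (t + 1)) + 2 * p\<^sup>2 / t)"
  have D: "(f has_real_derivative 2 * (p\<^sup>2 - t\<^sup>2) / (t\<^sup>2 * (t\<^sup>2 - 1))) (at t)" if "1 < t" for t
  proof -
    have nz: "t - 1 \<noteq> 0" "t + 1 \<noteq> 0" "t \<noteq> 0" "t\<^sup>2 - 1 \<noteq> 0"
      using that by (auto simp: power2_eq_1_iff)
    have "(f has_real_derivative (p\<^sup>2 - 1) * (1 / (t - 1) - 1 / (t + 1)) - 2 * p\<^sup>2 / (t * t)) (at t)"
      unfolding f_def by (rule derivative_eq_intros refl | use that in force)+
    moreover have "1 / (t - 1) - 1 / (t + 1) = 2 / (t\<^sup>2 - 1)"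
      using nz by (simp add: divide_simps power2_eq_square) (simp add: algebra_simps)
    moreover have "(p\<^sup>2 - 1) * (2 / (t\<^sup>2 - 1)) - 2 * p\<^sup>2 / (t * t) = 2 * (p\<^sup>2 - t\<^sup>2) / (t\<^sup>2 * (t\<^sup>2 - 1))"
      using nz by (simp add: divide_simps power2_eq_square) (simp add: algebra_simps)
    ultimately show ?thesis by simp
  qed
  have sq: "1 < t\<^sup>2" if "1 < t" for t :: real
    using that by (simp add: power2_eq_square less_1_mult)
  have "f r \<le> f p"
  proof (cases "r \<le> p")
    case True
    show ?thesis
    proof (rule DERIV_nonneg_imp_nondecreasing[OF True])
      fix t assume t: "r \<le> t" "t \<le> p"
      then have "1 < t" using assms by simp
      moreover have "t\<^sup>2 \<le> p\<^sup>2" using t \<open>1 < t\<close> by (intro power_mono) auto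
      then have "0 \<le> 2 * (p\<^sup>2 - t\<^sup>2) / (t\<^sup>2 * (t\<^sup>2 - 1))"
        using sq[OF \<open>1 < t\<close>] by (intro divide_nonneg_nonneg mult_nonneg_nonneg) auto
      ultimately show "\<exists>y. (f has_real_derivative y) (at t) \<and> 0 \<le> y" using D by blast
    qed
  next
    case False
    show ?thesis
    proof (rule DERIV_nonpos_imp_nonincreasing[of p r])
      show "p \<le> r" using False by simp
      fix t assume t: "p \<le> t" "t \<le> r"
      then have "1 < t" using p by simp
      moreover have "p\<^sup>2 \<le> t\<^sup>2" using t p by (intro power_mono) auto
      then have "2 * (p\<^sup>2 - t\<^sup>2) / (t\<^sup>2 * (t\<^sup>2 - 1)) \<le> 0"
        using sq[OF \<open>1 < t\<close>] by (intro divide_nonpos_nonneg mult_nonneg_nonneg) auto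
      ultimately show "\<exists>y. (f has_real_derivative y) (at t) \<and> y \<le> 0" using D by blast
    qed
  qed
  moreover have "f p = (p\<^sup>2 - 1) * log_ratio p + 2 * p" "f r = (p\<^sup>2 - 1) * log_ratio r + 2 * p\<^sup>2 / r"
    using p assms by (simp_all add: f_def log_ratio_def ln_div power2_eq_square)
  ultimately show ?thesis by (simp add: algebra_simps)
qed

text \<open>The tangent of the same concave function at \<open>1/r = 0\<close>, that is, at
  infinity.\<close>

lemma log_ratio_le:
  assumes "1 < r"
  shows "log_ratio r \<le> - 2 / r"
proof -
  define f where "f = (\<lambda>t::real. ln (1 - t) - ln (1 + t) + 2 * t)"
  have "f (1 / r) \<le> f 0"
  proof (rule DERIV_nonpos_imp_nonincreasing[of 0 "1 / r"])
    show "0 \<le> 1 / r" using assms by simp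
    fix t assume t: "0 \<le> t" "t \<le> 1 / r"
    moreover have "1 / r < 1" using assms by simp
    ultimately have t1: "0 \<le> t" "t < 1" by auto
    have D: "(f has_real_derivative - (1 / (1 - t)) - 1 / (1 + t) + 2) (at t)"
      unfolding f_def by (rule derivative_eq_intros refl | use t1 in force)+
    have "0 < 1 - t\<^sup>2" using t1 by (simp add: power_less_one_iff abs_square_less_1)
    moreover have "- (1 / (1 - t)) - 1 / (1 + t) + 2 = - (2 * t\<^sup>2 / (1 - t\<^sup>2))"
      using t1 \<open>0 < 1 - t\<^sup>2\<close> by (simp add: divide_simps power2_eq_square) (simp add: algebra_simps)
    ultimately have "- (1 / (1 - t)) - 1 / (1 + t) + 2 \<le> 0" by simp
    with D show "\<exists>y. (f has_real_derivative y) (at t) \<and> y \<le> 0" by blast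
  qed
  note f_le = this
  have "(r - 1) / (r + 1) = (1 - 1 / r) / (1 + 1 / r)"
    using assms by (simp add: divide_simps)
  moreover have "ln ((1 - 1 / r) / (1 + 1 / r)) = ln (1 - 1 / r) - ln (1 + 1 / r)"
    using assms by (intro ln_divide_pos) (simp_all add: add_pos_pos)
  ultimately have "log_ratio r = ln (1 - 1 / r) - ln (1 + 1 / r)"
    unfolding log_ratio_def by simp
  then show ?thesis using f_le by (simp add: f_def)
qed

lemma add_squared_divide_le:
  fixes p q r s :: real
  assumes "0 < r" "0 < s"
  shows "(p + q)\<^sup>2 / (r + s) \<le> p\<^sup>2 / r + q\<^sup>2 / s"
proof -
  have "p\<^sup>2 / r + q\<^sup>2 / s - (p + q)\<^sup>2 / (r + s) = (p * s - q * r)\<^sup>2 / (r * s * (r + s))"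
    using assms by (simp add: divide_simps power2_eq_square) (simp add: algebra_simps)
  also have "\<dots> \<ge> 0" using assms by simp
  finally show ?thesis by simp
qed

text \<open>Adds the tangents of \<open>ln\<close> at \<open>1 + 2 / (p + q)\<close> and of
  \<open>log_ratio\<close> at \<open>p\<close> and \<open>q\<close>. The weights turn the slopes in
  \<open>x\<close>, \<open>1/r\<close>, \<open>1/s\<close> into \<open>(p + q)^2\<close>,
  \<open>-2 * p^2\<close>, \<open>-2 * q^2\<close>, and \<open>add_squared_divide_le\<close> bounds
  what remains.\<close>

lemma tangent_bound:
  assumes "1 \<le> p" "1 \<le> q" "1 < r" "1 < s" "0 < x" "x \<le> 1 + 2 / (r + s)"
  shows "(p + q) * (p + q + 2) * ln x + (p\<^sup>2 - 1) * log_ratio r + (q\<^sup>2 - 1) * log_ratio s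
    \<le> (p + q) * (p + q + 2) * ln (1 + 2 / (p + q)) + (p\<^sup>2 - 1) * log_ratio p + (q\<^sup>2 - 1) * log_ratio q"
proof -
  let ?x0 = "1 + 2 / (p + q)"
  have x0: "0 < ?x0" using assms by (simp add: add_pos_pos)
  have "ln x - ln ?x0 = ln (x / ?x0)" using assms x0 by (simp add: ln_div)
  also have "\<dots> \<le> x / ?x0 - 1" using assms x0 by (intro ln_le_minus_one) auto
  finally have "(p + q) * (p + q + 2) * (ln x - ln ?x0) \<le> (p + q) * (p + q + 2) * (x / ?x0 - 1)"
    using assms by (intro mult_left_mono) auto
  also have "\<dots> = (p + q)\<^sup>2 * (x - ?x0)"
    using assms by (simp add: divide_simps power2_eq_square)
  also have "\<dots> \<le> (p + q)\<^sup>2 * (2 / (r + s) - 2 / (p + q))"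
    using assms by (intro mult_left_mono) auto
  also have "\<dots> = 2 * ((p + q)\<^sup>2 / (r + s)) - 2 * (p + q)"
  proof -
    have "p + q \<noteq> 0" using assms by simp
    then have "(p + q)\<^sup>2 * (2 / (p + q)) = 2 * (p + q)" by (simp add: power2_eq_square)
    then show ?thesis by (simp add: right_diff_distrib)
  qed
  also have "\<dots> \<le> 2 * (p\<^sup>2 / r + q\<^sup>2 / s) - 2 * (p + q)"
    using add_squared_divide_le[of r s p q] assms by simp
  finally show ?thesis
    using log_ratio_tangent[of p r] log_ratio_tangent[of q s] assms by (simp add: algebra_simps)
qed

text \<open>\<open>r\<close> and \<open>s\<close> invert \<open>y = (r - 1) / (r + 1)\<close> and
  \<open>z = (s - 1) / (s + 1)\<close>. The determinant condition is linear in \<open>x\<close>;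
  solving it gives the bound \<open>(2 - y - z) / (1 - y * z)\<close>, which equals
  \<open>1 + 2 / (r + s)\<close>.\<close>

lemma region_coordinates:
  assumes "region x y z" "y < 1" "z < 1"
  defines "r \<equiv> (1 + y) / (1 - y)" and "s \<equiv> (1 + z) / (1 - z)"
  shows "1 < r" "1 < s" "x \<le> 1 + 2 / (r + s)" "ln y = log_ratio r" "ln z = log_ratio s"
proof -
  have pos: "0 < x" "0 < y" "0 < z" and det: "x + y + z \<le> 2 + x * y * z"
    using assms by (auto simp: region_def)
  show "1 < r" "1 < s" using pos assms(2,3) by (simp_all add: r_def s_def)
  have "r - 1 = y * (r + 1)" "s - 1 = z * (s + 1)"
    using assms(2,3) by (simp_all add: r_def s_def field_simps)
  then have "(r - 1) / (r + 1) = y" "(s - 1) / (s + 1) = z"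
    using \<open>1 < r\<close> \<open>1 < s\<close> by (simp_all add: field_simps)
  then show "ln y = log_ratio r" "ln z = log_ratio s" by (simp_all add: log_ratio_def)
  have yz: "y * z < 1" using pos assms(2,3) mult_strict_mono[of y 1 z 1] by simp
  have rs: "r + s = 2 * (1 - y * z) / ((1 - y) * (1 - z))"
    using assms(2,3) unfolding r_def s_def by (simp add: divide_simps) (simp add: algebra_simps)
  then have "1 + 2 / (r + s) = (2 - y - z) / (1 - y * z)"
    using assms(2,3) yz unfolding rs by (simp add: divide_simps) (simp add: algebra_simps)
  moreover have "x * (1 - y * z) \<le> 2 - y - z" using det by (simp add: algebra_simps)
  ultimately show "x \<le> 1 + 2 / (r + s)" using yz by (simp add: pos_le_divide_eq)
qed

section \<open>Nonpositive discriminant: the upper bound 1\<close>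

lemma quadratic_form_nonneg:
  fixes b c d s t :: real
  assumes "0 \<le> b" "0 \<le> c" "d\<^sup>2 \<le> 4 * b * c"
  shows "0 \<le> b * s\<^sup>2 + d * (s * t) + c * t\<^sup>2"
proof (cases "b = 0")
  case True
  then show ?thesis using assms by simp
next
  case False
  have "4 * b * (b * s\<^sup>2 + d * (s * t) + c * t\<^sup>2) = (2 * b * s + d * t)\<^sup>2 + (4 * b * c - d\<^sup>2) * t\<^sup>2"
    by (simp add: power2_eq_square algebra_simps)
  also have "\<dots> \<ge> 0" using assms by simp
  finally show ?thesis using False assms(1) by (simp add: zero_le_mult_iff)
qed


lemma region_swap:
  assumes "region x y z"
  shows "region y x z" "region z y x"
  using assms by (auto simp: region_def mult_ac add_ac)

lemma region_gt_1:
  assumes "region x y z" "1 < x"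
  shows "y < 1" "z < 1"
proof -
  have "t < 1" if "x * t \<le> 1" "0 < t" for t
    using mult_strict_right_mono[OF assms(2) that(2)] that(1) by simp
  then show "y < 1" "z < 1" using assms by (auto simp: region_def)
qed

text \<open>The tangents at infinity reduce the claim to
  \<open>a / (r + s) \<le> b / r + c / s\<close>. Clearing denominators leaves a quadratic form in
  \<open>s\<close> and \<open>r\<close>, nonnegative by \<open>disc\<close>.\<close>

lemma weighted_log_nonpos_of_gt_1:
  assumes reg: "region x y z" and x: "1 < x"
    and nonneg: "0 \<le> a" "0 \<le> b" "0 \<le> c" and disc: "(b + c - a)\<^sup>2 \<le> 4 * b * c"
  shows "a * ln x + b * ln y + c * ln z \<le> 0"
proof -
  note lt = region_gt_1[OF reg x]
  note coords = region_coordinates[OF reg lt]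
  define r where "r = (1 + y) / (1 - y)"
  define s where "s = (1 + z) / (1 - z)"
  have r: "1 < r" "ln y = log_ratio r" and s: "1 < s" "ln z = log_ratio s"
    and xle: "x \<le> 1 + 2 / (r + s)"
    using coords by (simp_all add: r_def s_def)
  have "ln x \<le> x - 1" using x by (intro ln_le_minus_one) auto
  then have "ln x \<le> 2 / (r + s)" using xle by simp
  then have "a * ln x \<le> a * (2 / (r + s))" using nonneg by (intro mult_left_mono) auto
  moreover have "b * ln y \<le> b * (- 2 / r)" "c * ln z \<le> c * (- 2 / s)"
    using log_ratio_le[OF r(1)] log_ratio_le[OF s(1)] nonneg r(2) s(2) by (auto intro!: mult_left_mono simp del: mult_minus_right)
  moreover have "b / r + c / s - a / (r + s) =
      (b * s\<^sup>2 + (b + c - a) * (s * r) + c * r\<^sup>2) / (r * s * (r + s))"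
    using r(1) s(1) by (simp add: divide_simps power2_eq_square) (simp add: algebra_simps)
  moreover have "0 \<le> \<dots>"
    using quadratic_form_nonneg[OF nonneg(2,3) disc, of s r] r(1) s(1) by simp
  ultimately show ?thesis by simp
qed

lemma weighted_log_nonpos:
  assumes reg: "region x y z" and nonneg: "0 \<le> a" "0 \<le> b" "0 \<le> c"
    and disc: "a\<^sup>2 + b\<^sup>2 + c\<^sup>2 - 2 * a * b - 2 * a * c - 2 * b * c \<le> 0"
  shows "a * ln x + b * ln y + c * ln z \<le> 0"
proof -
  \<comment> \<open>The discriminant is symmetric in the weights, so it serves whichever ratio
    exceeds 1.\<close>
  have d: "(b + c - a)\<^sup>2 \<le> 4 * b * c" "(a + c - b)\<^sup>2 \<le> 4 * a * c" "(b + a - c)\<^sup>2 \<le> 4 * b * a"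
    using disc by (simp_all add: power2_eq_square algebra_simps)
  consider "1 < x" | "1 < y" | "1 < z" | "x \<le> 1" "y \<le> 1" "z \<le> 1" by linarith
  then show ?thesis
  proof cases
    case 1
    then show ?thesis using weighted_log_nonpos_of_gt_1[OF reg _ nonneg d(1)] by simp
  next
    case 2
    then show ?thesis
      using weighted_log_nonpos_of_gt_1[OF region_swap(1)[OF reg] _ nonneg(2,1,3) d(2)] by simp
  next
    case 3
    then show ?thesis
      using weighted_log_nonpos_of_gt_1[OF region_swap(2)[OF reg] _ nonneg(3,2,1) d(3)] by simp
  next
    case 4
    then have "a * ln x \<le> 0" "b * ln y \<le> 0" "c * ln z \<le> 0"
      using reg nonneg by (auto simp: region_def intro!: mult_nonneg_nonpos)
    then show ?thesis by simp
  qed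
qed

section \<open>Positive discriminant: the critical point and the supremum\<close>

lemma isCont_log_ratio: "1 < p \<Longrightarrow> isCont log_ratio p"
  unfolding log_ratio_def by (intro continuous_intros) auto

lemma log_ratio_tendsto_0: "(\<lambda>n. log_ratio (real (Suc (Suc n)))) \<longlonglongrightarrow> 0"
proof -
  let ?t = "\<lambda>n. inverse (real (Suc (Suc n)))"
  have "?t \<longlonglongrightarrow> 0" by (rule LIMSEQ_Suc[OF LIMSEQ_inverse_real_of_nat])
  then have "(\<lambda>n. ln ((1 - ?t n) / (1 + ?t n))) \<longlonglongrightarrow> ln ((1 - 0) / (1 + 0))"
    by (intro tendsto_intros) auto
  moreover have "log_ratio (real (Suc (Suc n))) = ln ((1 - ?t n) / (1 + ?t n))" for n
    unfolding log_ratio_def by (rule arg_cong[where f = ln]) (simp add: divide_simps)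
  ultimately show ?thesis by simp
qed

text \<open>These points lie on the surface where the determinant vanishes; the supremum is
  approached along it.\<close>

lemma region_point:
  assumes "1 < r" "1 < s"
  shows "region (1 + 2 / (r + s)) ((r - 1) / (r + 1)) ((s - 1) / (s + 1))"
proof -
  have 1: "(1 + 2 / (r + s)) * ((r - 1) / (r + 1)) = (r * r + r * s + r - s - 2) / (r * r + r * s + r + s)"
    if "1 < r" "1 < s" for r s :: real
  proof -
    have "0 < r * r + r * s + r + s" using that by (simp add: add_pos_pos)
    then show ?thesis using that by (simp add: divide_simps) (simp add: algebra_simps)
  qed
  have 2: "(1 + 2 / (r + s)) * ((r - 1) / (r + 1)) \<le> 1" if "1 < r" "1 < s" for r s :: real
    unfolding 1[OF that] using that by (simp add: divide_le_eq_1 add_pos_pos)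
  have "(r - 1) / (r + 1) \<le> 1" "(s - 1) / (s + 1) \<le> 1" using assms by simp_all
  then have "(r - 1) / (r + 1) * ((s - 1) / (s + 1)) \<le> 1 * 1"
    using assms by (intro mult_mono) auto
  moreover have "1 + 2 / (r + s) + (r - 1) / (r + 1) + (s - 1) / (s + 1)
    = 2 + (1 + 2 / (r + s)) * ((r - 1) / (r + 1)) * ((s - 1) / (s + 1))"
    using assms by (simp add: divide_simps) (simp add: algebra_simps)
  ultimately show ?thesis
    using assms 2[of r s] 2[of s r] unfolding region_def by (simp add: add.commute add_pos_pos)
qed

text \<open>Setting both partial derivatives on the surface \<open>x = 1 + 2 / (r + s)\<close> to
  zero makes \<open>a / ((p + q) * (p + q + 2))\<close>, \<open>b / (p^2 - 1)\<close> and
  \<open>c / (q^2 - 1)\<close> equal; \<open>k\<close> is their common value. The form without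
  quotients admits \<open>p = 1\<close> and \<open>q = 1\<close>, where a weight vanishes.\<close>

definition critical_weights :: "real \<Rightarrow> real \<Rightarrow> real \<Rightarrow> real \<Rightarrow> real \<Rightarrow> bool" where
  "critical_weights p q a b c \<longleftrightarrow> 1 \<le> p \<and> 1 \<le> q \<and>
     (\<exists>k>0. a = k * ((p + q) * (p + q + 2)) \<and> b = k * (p\<^sup>2 - 1) \<and> c = k * (q\<^sup>2 - 1))"

definition max_log :: "real \<Rightarrow> real \<Rightarrow> real \<Rightarrow> real \<Rightarrow> real \<Rightarrow> real" where
  "max_log p q a b c = a * ln (1 + 2 / (p + q)) + b * log_ratio p + c * log_ratio q"

lemma weighted_log_le_tangent:
  assumes crit: "critical_weights p q a b c"
    and rs: "1 < r" "1 < s" "0 < x" "x \<le> 1 + 2 / (r + s)"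
  shows "a * ln x + b * log_ratio r + c * log_ratio s \<le> max_log p q a b c"
proof -
  obtain k where p: "1 \<le> p" and q: "1 \<le> q" and k: "0 < k" and abc: "a = k * ((p + q) * (p + q + 2))"
    "b = k * (p\<^sup>2 - 1)" "c = k * (q\<^sup>2 - 1)"
    using crit by (auto simp: critical_weights_def)
  have "k * ((p + q) * (p + q + 2) * ln x + (p\<^sup>2 - 1) * log_ratio r + (q\<^sup>2 - 1) * log_ratio s)
    \<le> k * ((p + q) * (p + q + 2) * ln (1 + 2 / (p + q)) + (p\<^sup>2 - 1) * log_ratio p + (q\<^sup>2 - 1) * log_ratio q)"
    using tangent_bound[OF p q rs] k by (intro mult_left_mono) auto
  then show ?thesis unfolding max_log_def abc by (simp add: algebra_simps)
qed

text \<open>As \<open>r = s\<close> tends to infinity, all ratios tend to 1 and the weighted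
  logarithm to 0, while the tangent bound persists. Points with nonpositive weighted logarithm are
  thereby covered.\<close>

lemma max_log_nonneg:
  assumes "critical_weights p q a b c"
  shows "0 \<le> max_log p q a b c"
proof (rule LIMSEQ_le_const2)
  \<comment> \<open>Starting at 2 keeps \<open>?r n\<close> above 1.\<close>
  let ?r = "\<lambda>n. real (Suc (Suc n))"
  have "(\<lambda>n. inverse (?r n)) \<longlonglongrightarrow> 0"
    by (rule LIMSEQ_Suc[OF LIMSEQ_inverse_real_of_nat])
  then have "(\<lambda>n. a * ln (1 + inverse (?r n)) + b * log_ratio (?r n) + c * log_ratio (?r n))
      \<longlonglongrightarrow> a * ln (1 + 0) + b * 0 + c * 0"
    by (intro tendsto_intros log_ratio_tendsto_0) auto
  then show "(\<lambda>n. a * ln (1 + inverse (?r n)) + b * log_ratio (?r n) + c * log_ratio (?r n)) \<longlonglongrightarrow> 0"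
    by simp
  have "a * ln (1 + inverse (?r n)) + b * log_ratio (?r n) + c * log_ratio (?r n) \<le> max_log p q a b c" for n
    by (rule weighted_log_le_tangent[OF assms]) (simp_all add: field_simps add_pos_pos)
  then show "\<exists>N. \<forall>n\<ge>N. a * ln (1 + inverse (?r n)) + b * log_ratio (?r n) + c * log_ratio (?r n) \<le> max_log p q a b c"
    by blast
qed

lemma weighted_log_le_max_log:
  assumes crit: "critical_weights p q a b c" and reg: "region x y z"
  shows "a * ln x + b * ln y + c * ln z \<le> max_log p q a b c"
proof -
  obtain k where p: "1 \<le> p" and q: "1 \<le> q" and k: "0 < k" and abc: "a = k * ((p + q) * (p + q + 2))"
    "b = k * (p\<^sup>2 - 1)" "c = k * (q\<^sup>2 - 1)"
    using crit by (auto simp: critical_weights_def)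
  have pos: "0 < x" "0 < y" "0 < z" using reg by (auto simp: region_def)
  have nonneg: "0 \<le> b" "0 \<le> c" using k p q by (auto simp: abc one_le_power)
  \<comment> \<open>The first weight dominates: if \<open>y\<close> or \<open>z\<close> exceeds 1,
    its gain is offset by the loss in \<open>x\<close>, as \<open>x * y \<le> 1\<close> and
    \<open>x * z \<le> 1\<close>.\<close>
  have "p\<^sup>2 - 1 \<le> (p + q) * (p + q + 2)" "q\<^sup>2 - 1 \<le> (p + q) * (p + q + 2)"
    using p q by (simp_all add: power2_eq_square algebra_simps add_increasing)
  then have ab: "b \<le> a" and ac: "c \<le> a" using k by (simp_all add: abc)
  have le0: "a * ln x + b * ln y + c * ln z \<le> max_log p q a b c" if "a * ln x + b * ln y + c * ln z \<le> 0"
    using that max_log_nonneg[OF crit] by linarith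
  have lnxy: "ln x + ln y \<le> 0" and lnxz: "ln x + ln z \<le> 0"
    using reg by (auto simp: region_def simp flip: ln_mult_pos)
  consider "1 < x" | "1 < y" | "1 < z" | "x \<le> 1" "y \<le> 1" "z \<le> 1" by linarith
  then show ?thesis
  proof cases
    case 1
    note lt = region_gt_1[OF reg 1]
    show ?thesis
      using weighted_log_le_tangent[OF crit region_coordinates(1-2)[OF reg lt] pos(1) region_coordinates(3)[OF reg lt]]
        region_coordinates(4,5)[OF reg lt] by simp
  next
    case 2
    then have "x < 1" "z < 1" using region_gt_1[OF region_swap(1)[OF reg]] by auto
    then have "a * ln x \<le> b * ln x" "c * ln z \<le> 0"
      using ab nonneg pos by (auto intro!: mult_right_mono_neg mult_nonneg_nonpos)
    moreover have "b * (ln x + ln y) \<le> 0" using lnxy nonneg by (intro mult_nonneg_nonpos)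
    ultimately show ?thesis by (intro le0) (simp add: algebra_simps)
  next
    case 3
    then have "x < 1" "y < 1" using region_gt_1[OF region_swap(2)[OF reg]] by auto
    then have "a * ln x \<le> c * ln x" "b * ln y \<le> 0"
      using ac nonneg pos by (auto intro!: mult_right_mono_neg mult_nonneg_nonpos)
    moreover have "c * (ln x + ln z) \<le> 0" using lnxz nonneg by (intro mult_nonneg_nonpos)
    ultimately show ?thesis by (intro le0) (simp add: algebra_simps)
  next
    case 4
    then have "a * ln x \<le> 0" "b * ln y \<le> 0" "c * ln z \<le> 0"
      using pos nonneg ab by (auto intro!: mult_nonneg_nonpos)
    then show ?thesis by (intro le0) simp
  qed
qed

text \<open>If a weight vanishes then \<open>p = 1\<close> or \<open>q = 1\<close> and the supremum is not attained, hence the limit.\<close>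
lemma max_log_le:
  assumes crit: "critical_weights p q a b c"
    and le: "\<And>x y z. region x y z \<Longrightarrow> a * ln x + b * ln y + c * ln z \<le> m"
  shows "max_log p q a b c \<le> m"
proof (rule LIMSEQ_le_const2)
  obtain k where p: "1 \<le> p" and q: "1 \<le> q" and k: "0 < k" and abc: "a = k * ((p + q) * (p + q + 2))"
    "b = k * (p\<^sup>2 - 1)" "c = k * (q\<^sup>2 - 1)"
    using crit by (auto simp: critical_weights_def)
  let ?t = "\<lambda>n. inverse (real (Suc n))"
  have lim: "(\<lambda>n. u + ?t n) \<longlonglongrightarrow> u" for u :: real
    using tendsto_add[OF tendsto_const LIMSEQ_inverse_real_of_nat] by simp
  \<comment> \<open>At \<open>u = 1\<close>, where \<open>log_ratio\<close> is discontinuous, the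
    weight is 0 and the sequence is constant.\<close>
  have term_lim: "(\<lambda>n. w * log_ratio (u + ?t n)) \<longlonglongrightarrow> w * log_ratio u"
    if "w = k * (u\<^sup>2 - 1)" "1 \<le> u" for w u
  proof (cases "u = 1")
    case False
    then have "isCont log_ratio u" using that by (intro isCont_log_ratio) simp
    then show ?thesis by (intro tendsto_intros isCont_tendsto_compose[OF _ lim])
  qed (simp add: that)
  have "(\<lambda>n. ln (1 + 2 / ((p + ?t n) + (q + ?t n)))) \<longlonglongrightarrow> ln (1 + 2 / (p + q))"
    using p q by (intro tendsto_intros lim) (auto simp: add_nonneg_eq_0_iff divide_simps)
  then show "(\<lambda>n. a * ln (1 + 2 / ((p + ?t n) + (q + ?t n))) + b * log_ratio (p + ?t n)
      + c * log_ratio (q + ?t n)) \<longlonglongrightarrow> max_log p q a b c"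
    unfolding max_log_def by (intro tendsto_add tendsto_mult_left term_lim abc p q)
  have "region (1 + 2 / ((p + ?t n) + (q + ?t n))) ((p + ?t n - 1) / (p + ?t n + 1))
      ((q + ?t n - 1) / (q + ?t n + 1))" for n
  proof (rule region_point)
    have "0 < ?t n" by simp
    then show "1 < p + ?t n" "1 < q + ?t n" using p q by linarith+
  qed
  from le[OF this]
  show "\<exists>N. \<forall>n\<ge>N. a * ln (1 + 2 / ((p + ?t n) + (q + ?t n))) + b * log_ratio (p + ?t n)
      + c * log_ratio (q + ?t n) \<le> m"
    by (auto simp: log_ratio_def)
qed

section \<open>Closed form of the supremum\<close>

lemma powr_products_eq_exp:
  fixes x y z :: real
  assumes "0 < x" "0 < y" "0 < z"
  shows "x powr a * y powr b * z powr c = exp (a * ln x + b * ln y + c * ln z)"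
  using assms by (simp add: powr_def exp_add mult_ac)

lemma rpow_self: "0 \<le> x \<Longrightarrow> rpow x x = exp (x * ln x)"
  by (auto simp: rpow_def powr_def)

text \<open>The critical equations have a rational solution whose denominator is the discriminant;
  its positivity puts \<open>p\<close> and \<open>q\<close> at or above 1.\<close>

lemma critical_parameters:
  fixes a b c :: real
  assumes nonneg: "0 \<le> a" "0 \<le> b" "0 \<le> c" and sum: "a + b + c = 1"
    and A: "0 < 2 * a - 1" and disc: "4 * b * c < (2 * a - 1)\<^sup>2"
  obtains p q where "critical_weights p q a b c"
    "1 + 2 / (p + q) = 2 * a * (2 * a - 1) / ((1 - 2 * b) * (1 - 2 * c))"
    "log_ratio p = ln (2 * b * (1 - 2 * b) / ((1 - 2 * c) * (2 * a - 1)))"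
    "log_ratio q = ln (2 * c * (1 - 2 * c) / ((1 - 2 * b) * (2 * a - 1)))"
proof -
  define A where "A = 2 * a - 1"
  define B where "B = 1 - 2 * b"
  define C where "C = 1 - 2 * c"
  define Q where "Q = A\<^sup>2 - 4 * b * c"
  have Apos: "0 < A" using A by (simp add: A_def)
  have BC: "B = A + 2 * c" "C = A + 2 * b" using sum by (simp_all add: A_def B_def C_def)
  have pos: "0 < B" "0 < C" using BC Apos nonneg by simp_all
  have Qpos: "0 < Q" using disc by (simp add: Q_def A_def)
  have BplusC: "B + C = 2 * a" using sum by (simp add: B_def C_def)
  have Q1: "A * C - Q = 2 * b * B" and Q2: "A * B - Q = 2 * c * C"
    by (simp_all add: Q_def BC power2_eq_square algebra_simps)
  have Q3: "A * C + A * B - Q = B * C"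
    by (simp add: Q_def BC power2_eq_square algebra_simps)
  have Q4: "A * C + A * B = 2 * a * A"
  proof -
    have "A * C + A * B = A * (B + C)" by (simp add: algebra_simps)
    then show ?thesis unfolding BplusC by simp
  qed
  \<comment> \<open>Here \<open>u = (p + 1) / 2\<close> and \<open>v = (q + 1) / 2\<close>. The
    critical equations become \<open>A = 8 * k * u * v\<close>,
    \<open>B = 8 * k * v * (u + v - 1)\<close>, \<open>C = 8 * k * u * (u + v - 1)\<close>. Hence
    \<open>u : v = C : B\<close>, and the equation for \<open>A\<close> fixes the scale and
    \<open>k\<close>.\<close>
  define u where "u = A * C / Q"
  define v where "v = A * B / Q"
  define k where "k = Q\<^sup>2 / (8 * A * B * C)"
  have shifts: "u - 1 = (A * C - Q) / Q" "v - 1 = (A * B - Q) / Q"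
    "u + v = (A * C + A * B) / Q" "u + v - 1 = (A * C + A * B - Q) / Q"
    using Qpos by (simp_all add: u_def v_def diff_divide_distrib add_divide_distrib)
  note u1 = shifts(1)[unfolded Q1] and v1 = shifts(2)[unfolded Q2]
    and uv = shifts(3)[unfolded Q4] and uv1 = shifts(4)[unfolded Q3]
  have ge: "0 \<le> u - 1" "0 \<le> v - 1" unfolding u1 v1 using nonneg pos Qpos by simp_all
  have kabc: "k * (4 * (w1 / Q) * (w2 / Q)) = w1 * w2 / (2 * A * B * C)" for w1 w2
    using Qpos by (simp add: k_def power2_eq_square)
  have "2 * u - 1 + (2 * v - 1) = 2 * (u + v - 1)" by simp
  then have S: "2 * u - 1 + (2 * v - 1) = 2 * (B * C / Q)" by (simp only: uv1)
  have "2 * u - 1 + (2 * v - 1) + 2 = 2 * (u + v)" by simp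
  then have S2: "2 * u - 1 + (2 * v - 1) + 2 = 2 * (2 * a * A / Q)" by (simp only: uv)
  have sq: "(2 * w - 1)\<^sup>2 - 1 = 4 * w * (w - 1)" for w :: real
    by (simp add: power2_eq_square algebra_simps)
  have ratio: "log_ratio (2 * w - 1) = ln ((w - 1) / w)" if "1 \<le> w" for w
    unfolding log_ratio_def by (rule arg_cong[where f = ln]) (use that in \<open>simp add: field_simps\<close>)
  show thesis
  proof (rule that[of "2 * u - 1" "2 * v - 1"])
    have "0 < k" using Apos pos Qpos by (simp add: k_def)
    moreover have "1 \<le> 2 * u - 1" "1 \<le> 2 * v - 1" using ge by simp_all
    moreover have "k * (2 * (B * C / Q) * (2 * (2 * a * A / Q))) = k * (4 * (B * C / Q) * (2 * a * A / Q))"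
      by simp
    then have "a = k * ((2 * u - 1 + (2 * v - 1)) * (2 * u - 1 + (2 * v - 1) + 2))"
      unfolding S2 unfolding S kabc using Apos pos by simp
    moreover have "b = k * ((2 * u - 1)\<^sup>2 - 1)"
      unfolding sq u1 unfolding u_def kabc using Apos pos by simp
    moreover have "c = k * ((2 * v - 1)\<^sup>2 - 1)"
      unfolding sq v1 unfolding v_def kabc using Apos pos by simp
    ultimately show "critical_weights (2 * u - 1) (2 * v - 1) a b c"
      unfolding critical_weights_def by blast
    have "1 + 2 / (2 * u - 1 + (2 * v - 1)) = (u + v) / (u + v - 1)"
      using ge by (simp add: field_simps)
    then show "1 + 2 / (2 * u - 1 + (2 * v - 1)) = 2 * a * (2 * a - 1) / ((1 - 2 * b) * (1 - 2 * c))"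
      unfolding uv1 unfolding uv using Qpos by (simp flip: A_def B_def C_def)
    have "(u - 1) / u = 2 * b * B / (C * A)" "(v - 1) / v = 2 * c * C / (B * A)"
      unfolding u1 v1 unfolding u_def v_def using Qpos by (simp_all add: mult_ac)
    then show "log_ratio (2 * u - 1) = ln (2 * b * (1 - 2 * b) / ((1 - 2 * c) * (2 * a - 1)))"
      "log_ratio (2 * v - 1) = ln (2 * c * (1 - 2 * c) / ((1 - 2 * b) * (2 * a - 1)))"
      using ge by (simp_all add: ratio flip: A_def B_def C_def)
  qed
qed

text \<open>Collecting logarithms, 2 receives the exponent \<open>a + b + c = 1\<close>, and
  \<open>A\<close>, \<open>B\<close>, \<open>C\<close> receive \<open>A\<close>, \<open>-B\<close>,
  \<open>-C\<close>.\<close>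

lemma closed_form_eq_exp:
  fixes a b c :: real
  assumes nonneg: "0 \<le> a" "0 \<le> b" "0 \<le> c" and sum: "a + b + c = 1" and A: "0 < 2 * a - 1"
  shows "2 * rpow a a * rpow b b * rpow c c * rpow (2 * a - 1) (2 * a - 1)
      * rpow (1 - 2 * b) (2 * b - 1) * rpow (1 - 2 * c) (2 * c - 1)
    = exp (a * ln (2 * a * (2 * a - 1) / ((1 - 2 * b) * (1 - 2 * c)))
      + b * ln (2 * b * (1 - 2 * b) / ((1 - 2 * c) * (2 * a - 1)))
      + c * ln (2 * c * (1 - 2 * c) / ((1 - 2 * b) * (2 * a - 1))))"
proof -
  define A where "A = 2 * a - 1"
  define B where "B = 1 - 2 * b"
  define C where "C = 1 - 2 * c"
  have pos: "0 < A" "0 < B" "0 < C" using A nonneg sum by (simp_all add: A_def B_def C_def)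
  \<comment> \<open>For \<open>w = 0\<close> both sides vanish, whatever value \<open>ln 0\<close>
    has.\<close>
  have ln_term: "w * ln (2 * w * X / (Y * Z)) = w * (ln 2 + ln w + ln X - ln Y - ln Z)"
    if "0 \<le> w" "0 < X" "0 < Y" "0 < Z" for w X Y Z :: real
    using that by (cases "w = 0") (simp_all add: ln_mult ln_div)
  have neg: "rpow B (2 * b - 1) = exp (- B * ln B)" "rpow C (2 * c - 1) = exp (- C * ln C)"
    using pos by (simp_all add: rpow_def powr_def B_def C_def)
  have "a * ln (2 * a * A / (B * C)) + b * ln (2 * b * B / (C * A)) + c * ln (2 * c * C / (B * A))
    = (a + b + c) * ln 2 + a * ln a + b * ln b + c * ln c
      + (a - b - c) * ln A + (b - a - c) * ln B + (c - a - b) * ln C"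
    unfolding ln_term[OF nonneg(1) pos] ln_term[OF nonneg(2) pos(2,3,1)] ln_term[OF nonneg(3) pos(3,2,1)]
    by (simp add: algebra_simps)
  also have "\<dots> = ln 2 + a * ln a + b * ln b + c * ln c + A * ln A + - B * ln B + - C * ln C"
  proof -
    have "a - b - c = A" "b - a - c = - B" "c - a - b = - C"
      using sum by (simp_all add: A_def B_def C_def)
    then show ?thesis by (simp only: sum mult_1)
  qed
  finally show ?thesis
    unfolding A_def[symmetric] B_def[symmetric] C_def[symmetric] neg
    using nonneg pos by (simp only: rpow_self less_imp_le exp_add exp_ln zero_less_numeral)
qed

section \<open>Positive \<open>3\<times>3\<close> Lorentzian matrices\<close>

lemma det_3_by_3:
  fixes A :: "'a :: comm_ring_1 mat"
  assumes "A \<in> carrier_mat 3 3"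
  shows "det A =
    A $$ (0,0) * A $$ (1,1) * A $$ (2,2) + A $$ (0,1) * A $$ (1,2) * A $$ (2,0)
    + A $$ (0,2) * A $$ (1,0) * A $$ (2,1) - A $$ (0,2) * A $$ (1,1) * A $$ (2,0)
    - A $$ (0,1) * A $$ (1,0) * A $$ (2,2) - A $$ (0,0) * A $$ (1,2) * A $$ (2,1)"
proof -
  have det2: "det B = B $$ (0,0) * B $$ (1,1) - B $$ (0,1) * B $$ (1,0)"
    if B: "B \<in> carrier_mat 2 2" for B :: "'a mat"
  proof -
    have minor: "det (mat_delete B i 0) = B $$ (1 - i, 1)" if "i < 2" for i
    proof -
      have "mat_delete B i 0 \<in> carrier_mat 1 1"
        using B by (auto simp: mat_delete_def)
      then show ?thesis using B that by (auto simp: det_single mat_delete_def less_2_cases_iff)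
    qed
    show ?thesis
      using B minor[of 0] minor[of 1]
      by (subst laplace_expansion_column[OF B, of 0])
        (simp_all add: cofactor_def numeral_2_eq_2 algebra_simps)
  qed
  have "mat_delete A i 0 \<in> carrier_mat 2 2" for i
    using assms by (auto simp: mat_delete_def)
  then have minor: "det (mat_delete A i 0) = mat_delete A i 0 $$ (0,0) * mat_delete A i 0 $$ (1,1)
      - mat_delete A i 0 $$ (0,1) * mat_delete A i 0 $$ (1,0)" for i
    by (rule det2)
  have "mat_delete A i 0 $$ (k, l) = A $$ (if k < i then k else Suc k, Suc l)"
    if "k < 2" "l < 2" for i k l
    using assms that by (simp add: mat_delete_def)
  then have "det (mat_delete A 0 0) = A $$ (1,1) * A $$ (2,2) - A $$ (1,2) * A $$ (2,1)"
    "det (mat_delete A 1 0) = A $$ (0,1) * A $$ (2,2) - A $$ (0,2) * A $$ (2,1)"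
    "det (mat_delete A 2 0) = A $$ (0,1) * A $$ (1,2) - A $$ (0,2) * A $$ (1,1)"
    by (simp_all add: minor numeral_2_eq_2)
  moreover have "det A = A $$ (0,0) * det (mat_delete A 0 0) - A $$ (1,0) * det (mat_delete A 1 0)
      + A $$ (2,0) * det (mat_delete A 2 0)"
    by (subst laplace_expansion_column[OF assms, of 0])
      (simp_all add: cofactor_def numeral_3_eq_3 numeral_2_eq_2)
  ultimately show ?thesis by (simp only:) (simp add: algebra_simps)
qed

text \<open>Characteristic polynomial of the symmetric matrix with diagonal \<open>p, q, r\<close> and entries
  \<open>d, e, f\<close> at \<open>(0,1), (0,2), (1,2)\<close>.\<close>
definition char_cubic :: "real \<Rightarrow> real \<Rightarrow> real \<Rightarrow> real \<Rightarrow> real \<Rightarrow> real \<Rightarrow> real \<Rightarrow> real" where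
  "char_cubic p q r d e f t = (t - p) * (t - q) * (t - r)
     - (t - p) * f\<^sup>2 - (t - q) * e\<^sup>2 - (t - r) * d\<^sup>2 - 2 * d * e * f"

lemma poly_char_poly_3:
  fixes P :: "real mat"
  assumes P: "P \<in> carrier_mat 3 3" and sym: "transpose_mat P = P"
  shows "poly (char_poly P) t = char_cubic (P $$ (0,0)) (P $$ (1,1)) (P $$ (2,2))
    (P $$ (0,1)) (P $$ (0,2)) (P $$ (1,2)) t"
proof -
  have s: "P $$ (j, i) = P $$ (i, j)" if "i < 3" "j < 3" for i j
    using arg_cong[OF sym, of "\<lambda>M. M $$ (i, j)"] P that by simp
  have "- char_matrix P t \<in> carrier_mat 3 3"
    using P by (auto simp: char_matrix_def)
  moreover have "(- char_matrix P t) $$ (i, j) = (if i = j then t else 0) - P $$ (i, j)"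
    if "i < 3" "j < 3" for i j
    using P that by (auto simp: char_matrix_def)
  ultimately have "poly (char_poly P) t = 
     (t - P $$ (0,0)) * (t - P $$ (1,1)) * (t - P $$ (2,2)) - 2 * P $$ (0,1) * P $$ (0,2) * P $$ (1,2)
     - P $$ (0,2) * (t - P $$ (1,1)) * P $$ (0,2)
     - P $$ (0,1) * P $$ (0,1) * (t - P $$ (2,2)) - (t - P $$ (0,0)) * P $$ (1,2) * P $$ (1,2)"
    using s[of 0 1] s[of 0 2] s[of 1 2]
    by (simp add: char_poly_matrix[OF P] det_3_by_3 algebra_simps)
  then show ?thesis by (simp add: char_cubic_def power2_eq_square algebra_simps)
qed

section \<open>Sign conditions forced by at most one positive eigenvalue\<close>

lemma two_positive_roots:
  fixes p :: "real poly"
  assumes "p \<noteq> 0" "0 < s" "s < t" "poly p s = 0" "poly p t = 0"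
  shows "2 \<le> size {# x \<in># proots p. 0 < x #}"
proof -
  have "order s p \<noteq> 0" "order t p \<noteq> 0" using assms by (auto simp: order_root)
  then have "{#s, t#} \<subseteq># {# x \<in># proots p. 0 < x #}"
    using assms by (auto simp: subseteq_mset_def)
  then show ?thesis using size_mset_mono by fastforce
qed

text \<open>A monic cubic negative at \<open>t\<close> has a root beyond \<open>t\<close>, and a
  nonnegative value at \<open>s\<close> gives another between \<open>s\<close> and \<open>t\<close>:
  two distinct positive roots. Strictness at \<open>s = 0\<close> keeps the smaller one
  positive.\<close>

lemma Lorentzian_no_sign_change:
  fixes P :: "real mat"
  assumes P: "Lorentzian_mat 3 P" 
    and t: "0 \<le> s" "s < t" "0 \<le> poly (char_poly P) s" "s = 0 \<longrightarrow> 0 < poly (char_poly P) s" "poly (char_poly P) t < 0"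
  shows False
proof -
  let ?p = "char_poly P"
  have C: "P \<in> carrier_mat 3 3" using P by (simp add: Lorentzian_mat_def)
  have monic: "monic ?p" "degree ?p = 3" using degree_monic_char_poly[OF C] by auto
  obtain u where u: "s \<le> u" "u \<le> t" "poly ?p u = 0"
    using IVT2[of "poly ?p" t 0 s] t by auto
  have "u \<noteq> t" "0 < u" using t u by (auto simp: order_less_le)
  obtain n where "\<forall>x\<ge>n. lead_coeff ?p \<le> poly ?p x"
    using poly_pinfty_gt_lc[of ?p] monic by auto
  then have "1 \<le> poly ?p (max n (t + 1))" using monic by (simp del: le_max_iff_disj)
  then have "0 < poly ?p (max n (t + 1))" by simp
  then obtain v where "t \<le> v" "v \<le> max n (t + 1)" "poly ?p v = 0"
    using IVT[of "poly ?p" t 0 "max n (t + 1)"] t by (auto simp: le_max_iff_disj)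
  then have "2 \<le> size {# x \<in># proots ?p. 0 < x #}"
    using monic \<open>0 < u\<close> \<open>u \<noteq> t\<close> u by (intro two_positive_roots[of _ u v]) auto
  then show False using P by (simp add: Lorentzian_mat_def)
qed

text \<open>The point \<open>t\<close> is the smaller eigenvalue of the leading \<open>2\<times>2\<close> block, where Cauchy interlacing
  determines the sign of the characteristic polynomial.\<close>
lemma interlacing_point:
  fixes p q r d e f :: real
  assumes pos: "0 < p" "0 < q" "0 < d" "0 < e" "0 < f" and minor: "d\<^sup>2 < p * q"
  obtains t where "0 < t" "t < p" "t < q" "0 \<le> char_cubic p q r d e f t"
proof -
  have "\<exists>t. 0 \<le> t \<and> t \<le> min p q \<and> (p - t) * (q - t) = d\<^sup>2"
    by (rule IVT2) (use pos minor in \<open>auto simp: min_def\<close>)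
  then obtain t where t: "0 \<le> t" "t \<le> min p q" "(p - t) * (q - t) = d\<^sup>2" by blast
  have "t \<noteq> p" "t \<noteq> q" using t(3) pos by auto
  then have lt: "t < p" "t < q" using t(2) by auto
  have "t \<noteq> 0" using t(3) minor by auto
  \<comment> \<open>Splitting \<open>d\<close> into square roots makes the value of the cubic at
    \<open>t\<close> a perfect square.\<close>
  have d: "d = sqrt (p - t) * sqrt (q - t)"
    using t(3) pos real_sqrt_mult[of "p - t" "q - t"] by simp
  have "char_cubic p q r d e f t = (p - t) * f\<^sup>2 + (q - t) * e\<^sup>2 - 2 * d * e * f + (t - r) * ((p - t) * (q - t) - d\<^sup>2)"
    by (simp add: char_cubic_def algebra_simps)
  also have "\<dots> = (sqrt (p - t) * f - sqrt (q - t) * e)\<^sup>2"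
    using lt t(3) by (simp add: d power2_diff power_mult_distrib) 
  finally show thesis using that[of t] lt t(1) \<open>t \<noteq> 0\<close> by simp
qed

text \<open>The triple product vanishes there and only subtracted terms remain. This is the negative
  value that \<open>Lorentzian_no_sign_change\<close> requires.\<close>

lemma char_cubic_max_neg:
  fixes p q r d e f :: real
  assumes "0 < d" "0 < e" "0 < f"
  shows "char_cubic p q r d e f (max p (max q r)) < 0"
proof -
  let ?t = "max p (max q r)"
  have "0 < 2 * d * e * f" "0 \<le> (?t - p) * f\<^sup>2" "0 \<le> (?t - q) * e\<^sup>2" "0 \<le> (?t - r) * d\<^sup>2"
    using assms by simp_all
  moreover have "(?t - p) * (?t - q) * (?t - r) = 0" by (auto simp: max_def)
  ultimately show ?thesis unfolding char_cubic_def by linarith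
qed

text \<open>Simultaneous exchanges of rows and columns, which carry the leading block to the other
  two principal blocks.\<close>

lemma char_cubic_swap:
  "char_cubic p q r d e f = char_cubic p r q e d f"
  "char_cubic p q r d e f = char_cubic r q p f e d"
  by (simp_all add: char_cubic_def fun_eq_iff algebra_simps)

text \<open>A violated inequality yields a point left of the largest diagonal entry where the cubic
  is nonnegative: the interlacing point for a minor, and 0 for the determinant, since the cubic at 0
  is minus the determinant.\<close>

lemma Lorentzian_pos_3_minors:
  fixes P :: "real mat"
  assumes "P \<in> Lorentzian_pos 3"
  defines "p \<equiv> P $$ (0,0)" and "q \<equiv> P $$ (1,1)" and "r \<equiv> P $$ (2,2)"
    and "d \<equiv> P $$ (0,1)" and "e \<equiv> P $$ (0,2)" and "f \<equiv> P $$ (1,2)"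
  shows "p * q \<le> d\<^sup>2" "p * r \<le> e\<^sup>2" "q * r \<le> f\<^sup>2" "p * f\<^sup>2 + q * e\<^sup>2 + r * d\<^sup>2 \<le> p * q * r + 2 * d * e * f"
proof -
  have L: "Lorentzian_mat 3 P" using assms by (simp add: Lorentzian_pos_def)
  have pos: "0 < p" "0 < q" "0 < r" "0 < d" "0 < e" "0 < f"
    using assms by (auto simp: Lorentzian_pos_def)
  have poly: "poly (char_poly P) t = char_cubic p q r d e f t" for t
    using poly_char_poly_3[of P t] L by (simp add: Lorentzian_mat_def p_def q_def r_def d_def e_def f_def)
  have no: False if "0 \<le> s" "s < max p (max q r)" "0 \<le> char_cubic p q r d e f s"
      "s = 0 \<longrightarrow> 0 < char_cubic p q r d e f s" for s
    using Lorentzian_no_sign_change[OF L that(1,2)] that(3,4) char_cubic_max_neg[OF pos(4,5,6), of p q r]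
    by (simp add: poly)
  show "p * q \<le> d\<^sup>2"
  proof (rule ccontr)
    assume "\<not> p * q \<le> d\<^sup>2"
    then obtain t where "0 < t" "t < p" "t < q" "0 \<le> char_cubic p q r d e f t"
      using interlacing_point[of p q d e f r] pos by (auto simp: mult.commute)
    then show False using no[of t] by (simp add: less_max_iff_disj)
  qed
  show "p * r \<le> e\<^sup>2"
  proof (rule ccontr)
    assume "\<not> p * r \<le> e\<^sup>2"
    then obtain t where "0 < t" "t < p" "t < r" "0 \<le> char_cubic p r q e d f t"
      using interlacing_point[of p r e d f q] pos by (auto simp: mult.commute)
    then show False using no[of t] by (simp add: char_cubic_swap(1)[of p r q e d f] less_max_iff_disj)
  qed
  show "q * r \<le> f\<^sup>2"
  proof (rule ccontr)
    assume "\<not> q * r \<le> f\<^sup>2"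
    then obtain t where "0 < t" "t < r" "t < q" "0 \<le> char_cubic r q p f e d t"
      using interlacing_point[of r q f e d p] pos by (auto simp: mult.commute)
    then show False using no[of t] by (simp add: char_cubic_swap(2)[of r q p f e d] less_max_iff_disj)
  qed
  show "p * f\<^sup>2 + q * e\<^sup>2 + r * d\<^sup>2 \<le> p * q * r + 2 * d * e * f"
  proof (rule ccontr)
    assume "\<not> ?thesis"
    then have "0 < char_cubic p q r d e f 0" by (simp add: char_cubic_def)
    then show False using no[of 0] pos by (simp add: less_max_iff_disj)
  qed
qed

text \<open>A case of Descartes' rule of signs: dividing by a positive root \<open>s\<close> leaves
  \<open>t^2 + (s - e1) * t + e3 / s\<close>, whose coefficients are nonnegative, so it has no
  positive root.\<close>

lemma positive_roots_cubic_le_1: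
  fixes e1 e2 e3 :: real
  assumes "e2 \<le> 0" "0 \<le> e3"
  shows "size {# t \<in># proots [: - e3, e2, - e1, 1 :]. 0 < t #} \<le> 1"
proof (cases "\<exists>s > 0. poly [: - e3, e2, - e1, 1 :] s = 0")
  case True
  then obtain s where s: "0 < s" "poly [: - e3, e2, - e1, 1 :] s = 0" by blast
  define g where "g = [: e3 / s, s - e1, 1 :]"
  have e3: "e3 = s * (e2 - s * e1 + s * s)" using s(2) by (simp add: algebra_simps)
  have "e3 / s = e2 - s * e1 + s * s" using s(1) by (simp add: e3)
  then have "s * (s - e1) = e3 / s - e2" by (simp add: algebra_simps)
  moreover have "0 \<le> e3 / s" using assms s(1) by simp
  ultimately have "0 \<le> s * (s - e1)" using assms by linarith
  then have g: "0 \<le> e3 / s" "0 \<le> s - e1" using assms s(1) by (simp_all add: zero_le_mult_iff)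
  have "poly g t \<noteq> 0" if "0 < t" for t
  proof -
    have "0 < t * t" "0 \<le> t * (s - e1)" using g that by simp_all
    then have "0 < e3 / s + t * (s - e1) + t * t" using g by linarith
    then show ?thesis by (simp add: g_def algebra_simps)
  qed
  moreover have "g \<noteq> 0" by (simp add: g_def)
  ultimately have "{# t \<in># proots g. 0 < t #} = {#}" by (auto simp flip: set_mset_eq_empty_iff)
  moreover have "[: - e3, e2, - e1, 1 :] = [:- s, 1:] * g"
    using s \<open>e3 / s = _\<close> by (simp add: g_def algebra_simps)
  ultimately show ?thesis using \<open>g \<noteq> 0\<close> s(1) by (simp add: proots_mult del: mult_pCons_left)
next
  case False
  then have "{# t \<in># proots [: - e3, e2, - e1, 1 :]. 0 < t #} = {#}"
    by (auto simp flip: set_mset_eq_empty_iff)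
  then have "size {# t \<in># proots [: - e3, e2, - e1, 1 :]. 0 < t #} = 0" by (simp only: size_empty)
  then show ?thesis by linarith
qed

text \<open>In the characteristic polynomial, \<open>e2\<close> is the sum of the principal
  \<open>2x2\<close> minors and \<open>e3\<close> the determinant, so
  \<open>positive_roots_cubic_le_1\<close> applies.\<close>

lemma Lorentzian_pos_3I:
  fixes x y z :: real
  assumes pos: "0 < x" "0 < y" "0 < z" and minors: "x * y \<le> 1" "x * z \<le> 1" "y * z \<le> 1"
    and det: "x + y + z \<le> 2 + x * y * z"
  defines "P \<equiv> mat 3 3 (\<lambda>(i, j). if i \<noteq> j then 1 else if i = 0 then x else if i = 1 then y else z)"
  shows "P \<in> Lorentzian_pos 3"
proof -
  have C: "P \<in> carrier_mat 3 3" by (simp add: P_def)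
  have sym: "transpose_mat P = P" unfolding P_def by (rule eq_matI) auto
  have entries: "\<forall>i<3. \<forall>j<3. 0 < P $$ (i, j)" using pos by (simp add: P_def)
  have "poly (char_poly P) t = poly [: - (2 + x * y * z - x - y - z), x * y + x * z + y * z - 3, - (x + y + z), 1 :] t" for t
    unfolding poly_char_poly_3[OF C sym] char_cubic_def by (simp add: P_def algebra_simps)
  then have "char_poly P = [: - (2 + x * y * z - x - y - z), x * y + x * z + y * z - 3, - (x + y + z), 1 :]"
    using poly_eq_poly_eq_iff by blast
  moreover have "size {# t \<in># proots [: - (2 + x * y * z - x - y - z), x * y + x * z + y * z - 3, - (x + y + z), 1 :]. 0 < t #} \<le> 1"
    using minors det by (intro positive_roots_cubic_le_1) auto
  ultimately show ?thesis
    using C sym entries by (auto simp: Lorentzian_pos_def Lorentzian_mat_def less_imp_le)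
qed


section \<open>The optimal constant\<close>

text \<open>Diagonal scaling normalises \<open>P\<close>: products of two ratios are
  \<open>p * q / d^2\<close> and its analogues, and the determinant gets divided by
  \<open>d * e * f\<close>.\<close>

lemma triangular_ratios_region:
  assumes "P \<in> Lorentzian_pos 3"
  shows "region (triangular_ratio 1 2 0 P) (triangular_ratio 0 2 1 P) (triangular_ratio 0 1 2 P)"
proof -
  define p q r d e f where "p = P $$ (0,0)" and "q = P $$ (1,1)" and "r = P $$ (2,2)"
    and "d = P $$ (0,1)" and "e = P $$ (0,2)" and "f = P $$ (1,2)"
  note defs = p_def q_def r_def d_def e_def f_def
  have L: "P \<in> carrier_mat 3 3" "transpose_mat P = P"
    using assms by (simp_all add: Lorentzian_pos_def Lorentzian_mat_def)
  have "P $$ (j, i) = P $$ (i, j)" if "i < 3" "j < 3" for i j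
    using arg_cong[OF L(2), of "\<lambda>M. M $$ (i, j)"] L(1) that by simp
  then have sym: "P $$ (1, 0) = d" "P $$ (2, 0) = e" "P $$ (2, 1) = f"
    by (simp_all add: defs)
  have pos: "0 < p" "0 < q" "0 < r" "0 < d" "0 < e" "0 < f"
    using assms by (auto simp: Lorentzian_pos_def defs)
  have ratios: "triangular_ratio 1 2 0 P = f * p / (d * e)"
    "triangular_ratio 0 2 1 P = e * q / (d * f)" "triangular_ratio 0 1 2 P = d * r / (e * f)"
    by (simp_all only: triangular_ratio_def sym flip: defs)
  note minors = Lorentzian_pos_3_minors[OF assms, folded defs]
  have "f * p / (d * e) * (e * q / (d * f)) = p * q / d\<^sup>2"
    "f * p / (d * e) * (d * r / (e * f)) = p * r / e\<^sup>2"
    "e * q / (d * f) * (d * r / (e * f)) = q * r / f\<^sup>2"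
    using pos by (simp_all add: power2_eq_square)
  then have le: "f * p / (d * e) * (e * q / (d * f)) \<le> 1"
    "f * p / (d * e) * (d * r / (e * f)) \<le> 1" "e * q / (d * f) * (d * r / (e * f)) \<le> 1"
    using pos minors by (simp_all only: divide_le_eq_1) (simp_all add: less_imp_neq[symmetric])
  have "2 + f * p / (d * e) * (e * q / (d * f)) * (d * r / (e * f))
      - (f * p / (d * e) + e * q / (d * f) + d * r / (e * f))
    = (p * q * r + 2 * d * e * f - (p * f\<^sup>2 + q * e\<^sup>2 + r * d\<^sup>2)) / (d * e * f)"
    using pos by (simp add: divide_simps power2_eq_square)
  also have "0 \<le> \<dots>" using minors(4) pos by simp
  finally have det: "f * p / (d * e) + e * q / (d * f) + d * r / (e * f)
      \<le> 2 + f * p / (d * e) * (e * q / (d * f)) * (d * r / (e * f))"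
    by linarith
  show ?thesis unfolding region_def ratios using pos by (intro conjI le det) simp_all
qed

lemma triangular_ratios_surj:
  assumes "region x y z"
  obtains P where "P \<in> Lorentzian_pos 3" "triangular_ratio 1 2 0 P = x"
    "triangular_ratio 0 2 1 P = y" "triangular_ratio 0 1 2 P = z"
proof -
  have "mat 3 3 (\<lambda>(i, j). if i \<noteq> j then 1 else if i = 0 then x else if i = 1 then y else z) \<in> Lorentzian_pos 3"
    using assms by (intro Lorentzian_pos_3I) (auto simp: region_def)
  then show thesis by (rule that) (simp_all add: triangular_ratio_def)
qed

text \<open>Stated through a least upper bound because the supremum need not be attained; the
  admissible constants form the ray starting at \<open>exp m\<close>.\<close>

lemma optimal_bound_eq_exp:
  assumes ub: "\<And>x y z. region x y z \<Longrightarrow> a * ln x + b * ln y + c * ln z \<le> m"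
    and least: "\<And>m'. (\<And>x y z. region x y z \<Longrightarrow> a * ln x + b * ln y + c * ln z \<le> m') \<Longrightarrow> m \<le> m'"
  shows "optimal_bound a b c = ereal (exp m)"
proof -
  have products: "triangular_ratio 1 2 0 P powr a * triangular_ratio 0 2 1 P powr b * triangular_ratio 0 1 2 P powr c
      = exp (a * ln (triangular_ratio 1 2 0 P) + b * ln (triangular_ratio 0 2 1 P) + c * ln (triangular_ratio 0 1 2 P))"
    if "P \<in> Lorentzian_pos 3" for P
    using triangular_ratios_region[OF that] by (intro powr_products_eq_exp) (auto simp: region_def)
  have "0 < C \<and> (\<forall>P \<in> Lorentzian_pos 3. triangular_ratio 1 2 0 P powr a *
      triangular_ratio 0 2 1 P powr b * triangular_ratio 0 1 2 P powr c \<le> C) \<longleftrightarrow> exp m \<le> C" for C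
  proof
    assume C: "0 < C \<and> (\<forall>P \<in> Lorentzian_pos 3. triangular_ratio 1 2 0 P powr a *
      triangular_ratio 0 2 1 P powr b * triangular_ratio 0 1 2 P powr c \<le> C)"
    have "a * ln x + b * ln y + c * ln z \<le> ln C" if "region x y z" for x y z
    proof -
      obtain P where P: "P \<in> Lorentzian_pos 3" "triangular_ratio 1 2 0 P = x"
        "triangular_ratio 0 2 1 P = y" "triangular_ratio 0 1 2 P = z"
        by (rule triangular_ratios_surj[OF \<open>region x y z\<close>])
      then have "exp (a * ln x + b * ln y + c * ln z) \<le> C" using C products[OF P(1)] by auto
      then show ?thesis using C by (simp add: ln_ge_iff)
    qed
    then have "m \<le> ln C" by (rule least)
    then show "exp m \<le> C" using C by (simp add: ln_ge_iff)
  next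
    assume C: "exp m \<le> C"
    have "0 < C" using C exp_gt_zero[of m] by linarith
    moreover have "triangular_ratio 1 2 0 P powr a * triangular_ratio 0 2 1 P powr b *
        triangular_ratio 0 1 2 P powr c \<le> C" if "P \<in> Lorentzian_pos 3" for P
      unfolding products[OF that] using ub[OF triangular_ratios_region[OF that]] C
      by (meson exp_le_cancel_iff order_trans)
    ultimately show "0 < C \<and> (\<forall>P \<in> Lorentzian_pos 3. triangular_ratio 1 2 0 P powr a *
      triangular_ratio 0 2 1 P powr b * triangular_ratio 0 1 2 P powr c \<le> C)" by blast
  qed
  then have "optimal_bound a b c = Inf (ereal ` {exp m..})"
    by (simp add: optimal_bound_def atLeast_def)
  also have "\<dots> = ereal (exp m)" by (rule Inf_eqI) auto
  finally show ?thesis .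
qed

text \<open>Chooses the sign of the square root in \<open>disc\<close>: otherwise
  \<open>b + c - a\<close> is positive and at most \<open>b\<close> and \<open>c\<close>, so its
  square is at most \<open>b * c\<close>.\<close>

lemma sum_le_largest_weight:
  fixes a b c :: real
  assumes nonneg: "0 \<le> b" "0 \<le> c" and le: "b \<le> a" "c \<le> a"
    and disc: "4 * b * c \<le> (a - b - c)\<^sup>2"
  shows "b + c \<le> a"
proof (rule ccontr)
  assume "\<not> b + c \<le> a"
  then have w: "0 < b + c - a" "b + c - a \<le> b" "b + c - a \<le> c" using le by auto
  then have "(b + c - a) * (b + c - a) \<le> b * c" by (intro mult_mono) auto
  then have "4 * b * c \<le> b * c" using disc by (simp add: power2_eq_square algebra_simps)
  moreover have "0 < b * c" using w by (intro mult_pos_pos) linarith+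
  ultimately show False by simp
qed

theorem theoremC:
  fixes a b c :: real
  assumes "0 \<le> a" and "0 \<le> b" and "0 \<le> c" and "a + b + c = 1"
  shows "(a\<^sup>2 + b\<^sup>2 + c\<^sup>2 - 2 * a * b - 2 * a * c - 2 * b * c \<le> 0
            \<longrightarrow> optimal_bound a b c = 1) \<and>
         (a\<^sup>2 + b\<^sup>2 + c\<^sup>2 - 2 * a * b - 2 * a * c - 2 * b * c \<ge> 0 \<and> a \<ge> b \<and> a \<ge> c
            \<longrightarrow> optimal_bound a b c =
                ereal (2 * rpow a a * rpow b b * rpow c c
                  * rpow (2 * a - 1) (2 * a - 1)
                  * rpow (1 - 2 * b) (2 * b - 1)
                  * rpow (1 - 2 * c) (2 * c - 1)))"
proof (intro conjI impI)
  \<comment> \<open>The all-ones matrix shows that no constant below 1 is admissible.\<close>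
  have region_1: "region 1 1 1" by (simp add: region_def)
  have bound_1: "optimal_bound a b c = 1"
    if "a\<^sup>2 + b\<^sup>2 + c\<^sup>2 - 2 * a * b - 2 * a * c - 2 * b * c \<le> 0"
  proof -
    have "0 \<le> m" if "\<And>x y z. region x y z \<Longrightarrow> a * ln x + b * ln y + c * ln z \<le> m" for m
      using that[OF region_1] by simp
    then have "optimal_bound a b c = ereal (exp 0)"
      using weighted_log_nonpos[OF _ assms(1-3) that] by (intro optimal_bound_eq_exp) auto
    then show ?thesis by (simp add: one_ereal_def)
  qed
  then show "optimal_bound a b c = 1"
    if "a\<^sup>2 + b\<^sup>2 + c\<^sup>2 - 2 * a * b - 2 * a * c - 2 * b * c \<le> 0"
    using that .
  assume *: "a\<^sup>2 + b\<^sup>2 + c\<^sup>2 - 2 * a * b - 2 * a * c - 2 * b * c \<ge> 0 \<and> a \<ge> b \<and> a \<ge> c"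
  have diff: "a - b - c = 2 * a - 1" using assms(4) by simp
  have disc_eq: "a\<^sup>2 + b\<^sup>2 + c\<^sup>2 - 2 * a * b - 2 * a * c - 2 * b * c = (2 * a - 1)\<^sup>2 - 4 * b * c"
    unfolding diff[symmetric] by (simp add: power2_eq_square algebra_simps)
  have disc: "4 * b * c \<le> (2 * a - 1)\<^sup>2" using * disc_eq by linarith
  have "b + c \<le> a" using sum_le_largest_weight[of b c a] assms(2,3) * disc diff by simp
  then have A: "0 \<le> 2 * a - 1" using diff by linarith
  let ?form = "2 * rpow a a * rpow b b * rpow c c
                  * rpow (2 * a - 1) (2 * a - 1)
                  * rpow (1 - 2 * b) (2 * b - 1)
                  * rpow (1 - 2 * c) (2 * c - 1)"
  consider "2 * a - 1 = 0" | "0 < 2 * a - 1" "4 * b * c = (2 * a - 1)\<^sup>2"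
    | "0 < 2 * a - 1" "4 * b * c < (2 * a - 1)\<^sup>2"
    using A disc by linarith
  then show "optimal_bound a b c = ereal ?form"
  proof cases
    case 1
    \<comment> \<open>The weights are \<open>1/2, 0, 1/2\<close> or \<open>1/2, 1/2, 0\<close>; the
      factors \<open>0^0\<close> count as 1 and the two square roots cancel the 2.\<close>
    have half: "rpow (1 / 2) (1 / 2) = sqrt (1 / 2)" "rpow 0 0 = 1" "rpow 1 (- 1) = 1"
      by (simp_all add: rpow_def powr_half_sqrt)
    have "b * c \<le> 0" using disc 1 by simp
    then have "b = 0 \<or> c = 0" using assms(2,3) by (metis mult_pos_pos not_le order_le_less)
    then consider "a = 1 / 2" "b = 0" "c = 1 / 2" | "a = 1 / 2" "b = 1 / 2" "c = 0"
      using 1 assms(4) by fastforce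
    then have "?form = 1"
    proof cases
      case 1
      then show ?thesis unfolding 1 by (simp add: half real_sqrt_divide)
    next
      case 2
      then show ?thesis unfolding 2 by (simp add: half real_sqrt_divide)
    qed
    moreover have "optimal_bound a b c = 1"
      using 1 assms(2,3) by (intro bound_1, unfold disc_eq) simp
    ultimately show ?thesis by (simp add: one_ereal_def)
  next
    case 2
    have "0 < (2 * a - 1)\<^sup>2" using 2(1) by simp
    then have "0 < b * c" unfolding 2(2)[symmetric] by (simp add: mult.assoc)
    then have "0 < b" "0 < c" using assms(2,3) by (auto simp: zero_less_mult_iff)
    have BC: "1 - 2 * b = (2 * a - 1) + 2 * c" "1 - 2 * c = (2 * a - 1) + 2 * b"
      using assms(4) by simp_all
    \<comment> \<open>At vanishing discriminant, numerator and denominator agree in each logarithm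
      of the closed form, so it equals \<open>exp 0\<close>.\<close>
    have "(1 - 2 * b) * (1 - 2 * c) = 1 - 2 * (b + c) + 4 * b * c"
      by (simp add: algebra_simps)
    also have "b + c = 1 - a" using assms(4) by simp
    finally have "2 * a * (2 * a - 1) = (1 - 2 * b) * (1 - 2 * c)"
      unfolding 2(2) by (simp add: power2_eq_square algebra_simps)
    moreover have "2 * b * (1 - 2 * b) = (1 - 2 * c) * (2 * a - 1)"
      "2 * c * (1 - 2 * c) = (1 - 2 * b) * (2 * a - 1)"
      unfolding BC using 2(2) by (simp_all add: power2_eq_square algebra_simps)
    moreover have "0 < 1 - 2 * b" "0 < 1 - 2 * c" using BC 2(1) assms(2,3) by simp_all
    ultimately have "?form = 1"
      unfolding closed_form_eq_exp[OF assms 2(1)] using 2(1) by simp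
    moreover have "optimal_bound a b c = 1"
      using 2(2) by (intro bound_1) (simp add: disc_eq)
    ultimately show ?thesis by (simp add: one_ereal_def)
  next
    case 3
    obtain p q where crit: "critical_weights p q a b c"
      and vals: "1 + 2 / (p + q) = 2 * a * (2 * a - 1) / ((1 - 2 * b) * (1 - 2 * c))"
      "log_ratio p = ln (2 * b * (1 - 2 * b) / ((1 - 2 * c) * (2 * a - 1)))"
      "log_ratio q = ln (2 * c * (1 - 2 * c) / ((1 - 2 * b) * (2 * a - 1)))"
      by (rule critical_parameters[OF assms 3])
    have "optimal_bound a b c = ereal (exp (max_log p q a b c))"
      using weighted_log_le_max_log[OF crit] max_log_le[OF crit]
      by (intro optimal_bound_eq_exp) blast+
    then show ?thesis unfolding max_log_def closed_form_eq_exp[OF assms 3(1)] vals .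
  qed
qed

end
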